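(* Let $\alpha\subset\mathbb{R}^d$ be a floral vertex, and suppose $k$ is an integer with $0<k<d$. Then (i) the closure of every degree-$k$ genericity region of $\alpha$ is a $k$-dimensional face of $\alpha$, and (ii) every generalized coordinate hyperplane of dimension $k$, i.e. every set $\{x\in\mathbb{R}^d: x_i=0\ \forall i\in I\}$ with $I\subset\{1,\dots,d\}$ and $|I|=d-k$, contains precisely one $k$-dimensional face of $\alpha$.
   Context: **Floral vertices.** A series-parallel diagram (SPD) $\Delta$ with finite nonempty edge set $E$ is either a single edge, or a series connection $\Delta_1\wedge\Delta_2$, or a parallel connection $\Delta_1\vee\Delta_2$, of SPDs with disjoint nonempty edge sets whose union is $E$ (a read-once formula in $\wedge,\vee$). A signed SPD is a pair $(\Delta,s)$ with $s:E\to\{\pm1\}$. Let $H_i=\{x\in\mathbb{R}^d: x_i\ge 0\}$. If $E=\{1,\dots,d\}$, the floral vertex in $\mathbb{R}^d$ determined by $(\Delta,s)$ is the set obtained by interpreting edge $i$ as $s_iH_i$, series connection as intersection and parallel connection as union. It is a union of closed orthants $\Omega_s=\{x:s_ix_i\ge 0\ \forall i\}$, $s\in\{\pm1\}^d$. **Faces.** Let $\alpha\subset\mathbb{R}^d$ be a union of orthants. The tangent cone of $\alpha$ at $v\in\alpha$ is the union of orthants $\beta$ such that for some $\delta>0$, $\alpha\cap(v+[-\delta,\delta]^d)=v+(\beta\cap[-\delta,\delta]^d)$. The genericity region of $v\in\alpha$ is the set of points of $\alpha$ joined to $v$ by a path in $\alpha$ along which every tangent cone is congruent (under signed coordinate permutations)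 to the one at $v$. Its degree is the smallest dimension of a set of the form $\{x:x_i=\lambda_i\ \forall i\in I\}$ ($I\subset\{1,\dots,d\}$) containing it. A $k$-dimensional face of $\alpha$ is the closure of a genericity region of degree $k$. *)

theory Defs
  imports "HOL-Analysis.Analysis"
begin

datatype (edges: 'e) spd =
    Edge 'e
  | Series "'e spd" "'e spd"
  | Parallel "'e spd" "'e spd"

text \<open>The two parts of a connection must have disjoint edge sets, so every edge occurs once.\<close>

fun read_once :: "'e spd \<Rightarrow> bool" where
  "read_once (Edge e) \<longleftrightarrow> True"
| "read_once (Series D1 D2) \<longleftrightarrow> read_once D1 \<and> read_once D2 \<and> edges D1 \<inter> edges D2 = {}"
| "read_once (Parallel D1 D2) \<longleftrightarrow> read_once D1 \<and> read_once D2 \<and> edges D1 \<inter> edges D2 = {}"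

text \<open>The index set of the coordinates is the finite type \<open>'n\<close>, so \<open>d = CARD('n)\<close>.\<close>

definition sign_vector :: "('n \<Rightarrow> real) \<Rightarrow> bool" where
  "sign_vector s \<longleftrightarrow> (\<forall>i. s i \<in> {-1, 1})"

definition coord_halfspace :: "'n::finite \<Rightarrow> (real^'n) set" where
  "coord_halfspace i = {x. x $ i \<ge> 0}"

fun spd_region :: "('n::finite \<Rightarrow> real) \<Rightarrow> 'n spd \<Rightarrow> (real^'n) set" where
  "spd_region s (Edge i) = (*\<^sub>R) (s i) ` coord_halfspace i"
| "spd_region s (Series D1 D2) = spd_region s D1 \<inter> spd_region s D2"
| "spd_region s (Parallel D1 D2) = spd_region s D1 \<union> spd_region s D2"

definition floral_vertex :: "(real^'n) set \<Rightarrow> bool" where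
  "floral_vertex \<alpha> \<longleftrightarrow>
     (\<exists>D s. read_once D \<and> edges D = UNIV \<and> sign_vector s \<and> \<alpha> = spd_region s D)"

definition orthant :: "('n \<Rightarrow> real) \<Rightarrow> (real^'n::finite) set" where
  "orthant s = {x. \<forall>i. s i * x $ i \<ge> 0}"

definition union_of_orthants :: "(real^'n) set \<Rightarrow> bool" where
  "union_of_orthants \<alpha> \<longleftrightarrow> (\<exists>S. (\<forall>s\<in>S. sign_vector s) \<and> \<alpha> = (\<Union>s\<in>S. orthant s))"

definition cube :: "real \<Rightarrow> (real^'n) set" where
  "cube \<delta> = cbox (vec (-\<delta>)) (vec \<delta>)"

definition is_tangent_cone :: "(real^'n) set \<Rightarrow> real^'n \<Rightarrow> (real^'n) set \<Rightarrow> bool" where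
  "is_tangent_cone \<alpha> v \<beta> \<longleftrightarrow> union_of_orthants \<beta> \<and>
     (\<exists>\<delta>>0. \<alpha> \<inter> (+) v ` cube \<delta> = (+) v ` (\<beta> \<inter> cube \<delta>))"

definition tangent_cone :: "(real^'n) set \<Rightarrow> real^'n \<Rightarrow> (real^'n) set" where
  "tangent_cone \<alpha> v = (THE \<beta>. is_tangent_cone \<alpha> v \<beta>)"

text \<open>Tangent cones of unions of orthants exist and are unique, so the description above is
  proper (\<open>ex1_tangent_cone\<close>).\<close>

lemma mem_cube: "x \<in> cube \<delta> \<longleftrightarrow> (\<forall>i. \<bar>x $ i\<bar> \<le> \<delta>)"
  by (auto simp: cube_def mem_box_cart abs_le_iff minus_le_iff)

lemma is_tangent_cone_iff:
  "is_tangent_cone \<alpha> v \<beta> \<longleftrightarrow> union_of_orthants \<beta> \<and>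
     (\<exists>\<delta>>0. \<forall>x\<in>cube \<delta>. v + x \<in> \<alpha> \<longleftrightarrow> x \<in> \<beta>)"
proof -
  have "\<alpha> \<inter> (+) v ` cube \<delta> = (+) v ` (\<beta> \<inter> cube \<delta>) \<longleftrightarrow> (\<forall>x\<in>cube \<delta>. v + x \<in> \<alpha> \<longleftrightarrow> x \<in> \<beta>)" for \<delta>
  proof -
    have "(+) v ` A = {y. y - v \<in> A}" for A :: "(real^'a) set"
      by (force simp: image_iff algebra_simps)
    then have "\<alpha> \<inter> (+) v ` cube \<delta> = (+) v ` (\<beta> \<inter> cube \<delta>) \<longleftrightarrow>
        (\<forall>y. y - v \<in> cube \<delta> \<longrightarrow> (y \<in> \<alpha> \<longleftrightarrow> y - v \<in> \<beta>))"
      by auto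
    then show ?thesis
      by (metis add_diff_cancel_left' add.commute diff_add_cancel)
  qed
  then show ?thesis
    by (simp add: is_tangent_cone_def)
qed

lemma union_of_orthants_scale:
  assumes "union_of_orthants \<beta>" "c > 0"
  shows "c *\<^sub>R x \<in> \<beta> \<longleftrightarrow> x \<in> \<beta>"
proof -
  have "c *\<^sub>R x \<in> orthant s \<longleftrightarrow> x \<in> orthant s" for s
    using assms(2) by (simp add: orthant_def mult.left_commute[of _ c] zero_le_mult_iff[of c])
  then show ?thesis
    using assms(1) by (auto simp: union_of_orthants_def)
qed

lemma is_tangent_cone_mono:
  assumes "is_tangent_cone \<alpha> v \<beta>" "is_tangent_cone \<alpha> v \<gamma>"
  shows "\<beta> \<subseteq> \<gamma>"
proof
  fix x assume x: "x \<in> \<beta>"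
  obtain a b where a: "a > 0" "\<forall>x\<in>cube a. v + x \<in> \<alpha> \<longleftrightarrow> x \<in> \<beta>"
    and b: "b > 0" "\<forall>x\<in>cube b. v + x \<in> \<alpha> \<longleftrightarrow> x \<in> \<gamma>"
    using assms by (auto simp: is_tangent_cone_iff)
  define c where "c = min a b / (1 + norm x)"
  have c: "c > 0"
    using a b by (simp add: c_def add_pos_nonneg)
  have "\<bar>(c *\<^sub>R x) $ i\<bar> \<le> min a b" for i
  proof -
    have "c * \<bar>x $ i\<bar> \<le> c * (1 + norm x)"
      using c component_le_norm_cart[of x i] by (intro mult_left_mono) linarith+
    also have "\<dots> = min a b"
    proof -
      have "1 + norm x \<noteq> 0"
        by (smt (verit) norm_ge_zero)
      then show ?thesis
        by (simp add: c_def)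
    qed
    finally show ?thesis
      using c by (simp add: abs_mult)
  qed
  then have "c *\<^sub>R x \<in> cube a" "c *\<^sub>R x \<in> cube b"
    by (simp_all add: mem_cube)
  with a b x assms c show "x \<in> \<gamma>"
    by (metis is_tangent_cone_def union_of_orthants_scale)
qed

lemma ex1_tangent_cone:
  fixes \<alpha> :: "(real^'n) set"
  assumes "union_of_orthants \<alpha>"
  shows "\<exists>!\<beta>. is_tangent_cone \<alpha> v \<beta>"
proof -
  obtain S where S: "\<forall>s\<in>S. sign_vector s" "\<alpha> = (\<Union>s\<in>S. orthant s)"
    using assms by (auto simp: union_of_orthants_def)
  define T where "T = {t. sign_vector t \<and> (\<exists>s\<in>S. v \<in> orthant s \<and> (\<forall>i. v $ i = 0 \<longrightarrow> t i = s i))}"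
  define \<delta> where "\<delta> = Min (insert 1 ((\<lambda>i. \<bar>v $ i\<bar> / 2) ` {i. v $ i \<noteq> 0}))"
  have \<delta>: "\<delta> > 0"
    by (auto simp: \<delta>_def)
  have le: "\<delta> \<le> \<bar>v $ i\<bar> / 2" if "v $ i \<noteq> 0" for i
    unfolding \<delta>_def by (rule Min_le) (use that in auto)
  have "v + x \<in> \<alpha> \<longleftrightarrow> x \<in> (\<Union>t\<in>T. orthant t)" if x: "x \<in> cube \<delta>" for x
  proof
    have small: "\<bar>x $ i\<bar> < \<bar>v $ i\<bar>" if "v $ i \<noteq> 0" for i
      using le[OF that] x that unfolding mem_cube by (smt (verit) field_sum_of_halves)
    {
      assume "v + x \<in> \<alpha>"
      then obtain s where s: "s \<in> S" "v + x \<in> orthant s"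
        using S by auto
      define t where "t = (\<lambda>i. if v $ i = 0 then s i else if x $ i \<ge> 0 then 1 else -1)"
      have sv: "s i = 1 \<or> s i = -1" for i
        using s S by (auto simp: sign_vector_def)
      have "0 \<le> s i * v $ i" for i
        using s sv[of i] small[of i] by (cases "v $ i = 0") (auto simp: orthant_def dest!: spec[of _ i])
      then have "v \<in> orthant s"
        by (simp add: orthant_def)
      moreover have "sign_vector t"
        using sv by (auto simp: sign_vector_def t_def)
      ultimately have "t \<in> T"
        using s by (auto simp: T_def t_def)
      moreover have "0 \<le> t i * x $ i" for i
        using s by (auto simp: orthant_def t_def dest!: spec[of _ i])
      ultimately show "x \<in> (\<Union>t\<in>T. orthant t)"
        by (auto simp: orthant_def)
    }
    {
      assume "x \<in> (\<Union>t\<in>T. orthant t)"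
      then obtain t s where t: "x \<in> orthant t" "s \<in> S" "v \<in> orthant s" "\<And>i. v $ i = 0 \<Longrightarrow> t i = s i"
        by (auto simp: T_def)
      have sv: "s i = 1 \<or> s i = -1" for i
        using t S by (auto simp: sign_vector_def)
      have "0 \<le> s i * (v $ i + x $ i)" for i
        using t(1,3) t(4)[of i] sv[of i] small[of i]
        by (cases "v $ i = 0") (auto simp: orthant_def dest!: spec[of _ i])
      then show "v + x \<in> \<alpha>"
        using t S by (auto simp: orthant_def)
    }
  qed
  moreover have "union_of_orthants (\<Union>t\<in>T. orthant t)"
    unfolding union_of_orthants_def by (rule exI[of _ T]) (simp add: T_def)
  ultimately have "is_tangent_cone \<alpha> v (\<Union>t\<in>T. orthant t)"
    using \<delta> by (auto simp: is_tangent_cone_iff)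
  then show ?thesis
    using is_tangent_cone_mono by (blast intro: equalityI)
qed

definition congruent_sets :: "(real^'n) set \<Rightarrow> (real^'n) set \<Rightarrow> bool" where
  "congruent_sets \<beta> \<gamma> \<longleftrightarrow>
     (\<exists>\<pi> \<epsilon>. bij \<pi> \<and> sign_vector \<epsilon> \<and> \<gamma> = (\<lambda>x. \<chi> i. \<epsilon> i * x $ \<pi> i) ` \<beta>)"

definition genericity_region :: "(real^'n) set \<Rightarrow> real^'n \<Rightarrow> (real^'n) set" where
  "genericity_region \<alpha> v = {w \<in> \<alpha>. \<exists>g. path g \<and> path_image g \<subseteq> \<alpha> \<and> pathstart g = v \<and> pathfinish g = w \<and>
     (\<forall>u \<in> path_image g. congruent_sets (tangent_cone \<alpha> v) (tangent_cone \<alpha> u))}"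

definition is_genericity_region :: "(real^'n) set \<Rightarrow> (real^'n) set \<Rightarrow> bool" where
  "is_genericity_region \<alpha> G \<longleftrightarrow> (\<exists>v\<in>\<alpha>. G = genericity_region \<alpha> v)"

definition coord_flat :: "'n set \<Rightarrow> ('n \<Rightarrow> real) \<Rightarrow> (real^'n::finite) set" where
  "coord_flat I c = {x. \<forall>i\<in>I. x $ i = c i}"

definition region_degree :: "(real^'n) set \<Rightarrow> nat" where
  "region_degree G = (LEAST n. \<exists>I c. G \<subseteq> coord_flat I c \<and> aff_dim (coord_flat I c) = int n)"

definition is_face :: "(real^'n) set \<Rightarrow> nat \<Rightarrow> (real^'n) set \<Rightarrow> bool" where
  "is_face \<alpha> k F \<longleftrightarrow> (\<exists>G. is_genericity_region \<alpha> G \<and> region_degree G = k \<and> F = closure G)"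

end

theory Submission
  imports Defs
begin

text \<open>
  The tangent cone at \<open>v\<close> is the read-once formula with the variables of nonzero coordinates fixed
  to their truth values. Let \<open>support v\<close> be the set of coordinates on which the remaining Boolean
  function depends. Its cardinality is a congruence invariant of the tangent cone, and moving from
  \<open>v\<close> to a nearby point specializes the formula further, so that \<open>support\<close> can only shrink locally.
  Hence \<open>support\<close> is constant along the paths defining a genericity region, which therefore has
  degree \<open>d - |support v|\<close> and lies in exactly those flats through 0 whose index set is contained in
  \<open>support v\<close>. For \<open>I \<noteq> {}\<close>, the set of all \<open>v\<close> with \<open>support v = I\<close> is nonempty and starlike
  (induction on the formula): every subformula disjoint from \<open>I\<close> must become constantly true next to
  a series connection and constantly false next to a parallel one, and the monotone regions where
  this happens are starlike about \<open>s\<close> and \<open>-s\<close>. So it is a single genericity region.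
\<close>

section \<open>Variables on which a function depends\<close>

text \<open>The argument type is left open: the notion serves both Boolean formulas and membership
  in a cone as a function of real coordinates.\<close>

definition essential :: "(('n \<Rightarrow> 'b) \<Rightarrow> 'c) \<Rightarrow> 'n set" where
  "essential f = {i. \<exists>x y. (\<forall>j. j \<noteq> i \<longrightarrow> x j = y j) \<and> f x \<noteq> f y}"

lemma essentialI: "(\<And>j. j \<noteq> i \<Longrightarrow> x j = y j) \<Longrightarrow> f x \<noteq> f y \<Longrightarrow> i \<in> essential f"
  unfolding essential_def by blast

lemma essentialE:
  assumes "i \<in> essential f"
  obtains x y where "\<And>j. j \<noteq> i \<Longrightarrow> x j = y j" "f x \<noteq> f y"
  using assms unfolding essential_def by blast

text \<open>The index type is finite, so \<open>x\<close> can be turned into \<open>y\<close> one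
  coordinate at a time: an essential coordinate needs no change, and any other cannot affect the
  value.\<close>

lemma essential_cong:
  fixes f :: "('n::finite \<Rightarrow> 'b) \<Rightarrow> 'c"
  assumes "\<And>i. i \<in> essential f \<Longrightarrow> x i = y i"
  shows "f x = f y"
proof -
  have "f (\<lambda>i. if i \<in> A then y i else x i) = f x" for A :: "'n set"
    using finite[of A]
  proof induction
    case (insert a A)
    let ?z = "\<lambda>A i. if i \<in> A then y i else x i"
    have "f (?z (insert a A)) = f (?z A)"
    proof (cases "a \<in> essential f")
      case True
      then have "?z (insert a A) = ?z A"
        using assms[of a] by auto
      then show ?thesis
        by (rule arg_cong)
    next
      case False
      show ?thesis
      proof (rule ccontr)
        assume "f (?z (insert a A)) \<noteq> f (?z A)"
        with False show False
          using essentialI[of a "?z (insert a A)" "?z A" f] by auto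
      qed
    qed
    with insert show ?case
      by simp
  qed simp
  from this[of UNIV] show ?thesis
    by simp
qed

lemma essential_subset:
  assumes "\<And>x y. (\<And>i. i \<in> A \<Longrightarrow> x i = y i) \<Longrightarrow> f x = f y"
  shows "essential f \<subseteq> A"
proof
  fix i assume "i \<in> essential f"
  then obtain x y where xy: "\<And>j. j \<noteq> i \<Longrightarrow> x j = y j" "f x \<noteq> f y"
    by (rule essentialE) blast
  show "i \<in> A"
  proof (rule ccontr)
    assume "i \<notin> A"
    then have "f x = f y"
      by (intro assms xy(1)) auto
    with xy(2) show False ..
  qed
qed

lemma essential_eq_empty_iff:
  fixes f :: "('n::finite \<Rightarrow> 'b) \<Rightarrow> 'c"
  shows "essential f = {} \<longleftrightarrow> (\<forall>x y. f x = f y)"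
proof
  assume "essential f = {}"
  then show "\<forall>x y. f x = f y"
    by (intro allI essential_cong[of f]) simp
qed (simp add: essential_def)

lemma essential_not: "essential (\<lambda>x. \<not> f x) = essential f"
  by (simp add: essential_def)

text \<open>With the variables outside \<open>essential f\<close> frozen to a satisfying assignment
  of \<open>g\<close>, the conjunction becomes \<open>f\<close>.\<close>

lemma essential_conj_aux:
  fixes f g :: "('n::finite \<Rightarrow> 'b) \<Rightarrow> bool"
  assumes "essential f \<inter> essential g = {}" "g z" "i \<in> essential f"
  shows "i \<in> essential (\<lambda>x. f x \<and> g x)"
proof -
  obtain x y where xy: "\<And>j. j \<noteq> i \<Longrightarrow> x j = y j" "f x \<noteq> f y"
    using assms(3) by (rule essentialE) blast
  define m where "m x j = (if j \<in> essential f then x j else z j)" for x j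
  have "f (m w) = f w" for w
    by (rule essential_cong[of f "m w" w]) (simp add: m_def)
  moreover have "g (m w) = g z" for w
    by (rule essential_cong[of g "m w" z]) (use assms(1) in \<open>auto simp: m_def\<close>)
  ultimately show ?thesis
    using xy assms(2) by (intro essentialI[of _ "m x" "m y"]) (auto simp: m_def)
qed

text \<open>An unsatisfiable factor makes the conjunction constantly false and so erases the
  variables of the other factor.\<close>

lemma essential_conj:
  fixes f g :: "('n::finite \<Rightarrow> 'b) \<Rightarrow> bool"
  assumes "essential f \<inter> essential g = {}"
  shows "essential (\<lambda>x. f x \<and> g x) =
    (if \<exists>x. g x then essential f else {}) \<union> (if \<exists>x. f x then essential g else {})"
proof (intro equalityI subsetI)
  fix i assume "i \<in> essential (\<lambda>x. f x \<and> g x)"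
  then obtain x y where xy: "\<And>j. j \<noteq> i \<Longrightarrow> x j = y j" "(f x \<and> g x) \<noteq> (f y \<and> g y)"
    by (rule essentialE) blast
  have "f x \<noteq> f y \<Longrightarrow> i \<in> essential f" "g x \<noteq> g y \<Longrightarrow> i \<in> essential g"
    using xy(1) by (blast intro: essentialI)+
  with xy(2) show "i \<in> (if \<exists>x. g x then essential f else {}) \<union> (if \<exists>x. f x then essential g else {})"
    by auto
next
  have com: "(\<lambda>x. g x \<and> f x) = (\<lambda>x. f x \<and> g x)"
    by auto
  fix i assume "i \<in> (if \<exists>x. g x then essential f else {}) \<union> (if \<exists>x. f x then essential g else {})"
  then show "i \<in> essential (\<lambda>x. f x \<and> g x)"
    using assms essential_conj_aux[of f g _ i] essential_conj_aux[of g f _ i]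
    by (auto split: if_splits simp: com Int_commute)
qed

text \<open>This splits a prescribed support into conditions on two parts with edge sets
  \<open>A\<close> and \<open>B\<close>. If \<open>I\<close> misses \<open>B\<close>, then
  \<open>g\<close> must be constantly true, since a constantly false \<open>g\<close> would erase
  the variables of \<open>f\<close>.\<close>

lemma essential_conj_eq_iff:
  fixes f g :: "('n::finite \<Rightarrow> 'b) \<Rightarrow> bool"
  assumes "essential f \<subseteq> A" "essential g \<subseteq> B" "A \<inter> B = {}" "I \<inter> A \<noteq> {}"
  shows "essential (\<lambda>x. f x \<and> g x) = I \<inter> (A \<union> B) \<longleftrightarrow>
    essential f = I \<inter> A \<and> (if I \<inter> B = {} then \<forall>x. g x else essential g = I \<inter> B)"
proof -
  have disj: "essential f \<inter> essential g = {}"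
    using assms by blast
  have sat: "\<exists>x. f x" if "essential f \<noteq> {}" for f :: "('n \<Rightarrow> 'b) \<Rightarrow> bool"
    using that by (auto elim: essentialE)
  have taut: "(\<forall>x. g x) \<longleftrightarrow> essential g = {} \<and> (\<exists>x. g x)"
    by (auto simp: essential_eq_empty_iff)
  show ?thesis
  proof (cases "\<exists>x. f x")
    case True
    show ?thesis
    proof (cases "\<exists>x. g x")
      case True
      with \<open>\<exists>x. f x\<close> assms show ?thesis
        unfolding essential_conj[OF disj] taut by auto
    next
      case False
      then have "essential g = {}"
        using sat by blast
      with False \<open>\<exists>x. f x\<close> assms show ?thesis
        unfolding essential_conj[OF disj] taut by auto
    qed
  next
    case False
    then have "essential f = {}"
      using sat by blast
    with False assms show ?thesis
      unfolding essential_conj[OF disj] by (auto 0 3 split: if_splits)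
  qed
qed

text \<open>Passing to real arguments loses nothing, because each half-line test takes both truth
  values.\<close>

lemma essential_comp_halfspace:
  fixes f :: "('n \<Rightarrow> bool) \<Rightarrow> 'c" and s :: "'n \<Rightarrow> real"
  assumes "\<And>i. s i \<noteq> 0"
  shows "essential (\<lambda>x. f (\<lambda>i. 0 \<le> s i * x i)) = essential f"
proof (intro equalityI subsetI)
  fix i assume "i \<in> essential (\<lambda>x. f (\<lambda>i. 0 \<le> s i * x i))"
  then obtain x y where "\<And>j. j \<noteq> i \<Longrightarrow> x j = y j"
      "f (\<lambda>i. 0 \<le> s i * x i) \<noteq> f (\<lambda>i. 0 \<le> s i * y i)"
    by (rule essentialE) blast
  then show "i \<in> essential f"
    by (intro essentialI[of _ "\<lambda>i. 0 \<le> s i * x i" "\<lambda>i. 0 \<le> s i * y i"]) auto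
next
  fix i assume "i \<in> essential f"
  then obtain x y where xy: "\<And>j. j \<noteq> i \<Longrightarrow> x j = y j" "f x \<noteq> f y"
    by (rule essentialE) blast
  \<comment> \<open>\<open>r\<close> lifts an assignment to real coordinates: \<open>s i\<close>
    passes the test at \<open>i\<close>, and \<open>- s i\<close> fails it.\<close>
  define r where "r x i = (if x i then s i else - s i)" for x i
  have "(\<lambda>i. 0 \<le> s i * r x i) = x" for x
  proof
    show "(0 \<le> s i * r x i) = x i" for i
      using assms[of i] by (auto simp: r_def mult_le_0_iff zero_le_mult_iff)
  qed
  then show "i \<in> essential (\<lambda>x. f (\<lambda>i. 0 \<le> s i * x i))"
    using xy by (intro essentialI[of _ "r x" "r y"]) (auto simp: r_def)
qed

text \<open>A signed permutation only relabels coordinates and flips signs, so it carries essential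
  coordinates to essential coordinates bijectively.\<close>

lemma congruent_sets_card_essential:
  fixes \<beta> \<gamma> :: "(real^'n) set"
  assumes "congruent_sets \<beta> \<gamma>"
  shows "card (essential (\<lambda>x. vec_lambda x \<in> \<beta>)) = card (essential (\<lambda>x. vec_lambda x \<in> \<gamma>))"
proof -
  obtain \<pi> \<epsilon> where pe: "bij \<pi>" "sign_vector \<epsilon>" "\<gamma> = (\<lambda>x. \<chi> i. \<epsilon> i * x $ \<pi> i) ` \<beta>"
    using assms by (auto simp: congruent_sets_def)
  have sq: "\<epsilon> i * (\<epsilon> i * a) = a" for i a
    using pe(2) by (auto simp: sign_vector_def dest!: spec[of _ i])
  have inv: "\<pi> (inv \<pi> i) = i" "inv \<pi> (\<pi> i) = i" for i
    using pe(1) by (auto simp: bij_is_surj surj_f_inv_f bij_is_inj)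
  have inv_iff: "\<pi> i = j \<longleftrightarrow> i = inv \<pi> j" "inv \<pi> j = i \<longleftrightarrow> j = \<pi> i" for i j
    using inv by metis+
  have inj: "inj (\<lambda>x::real^'n. \<chi> i. \<epsilon> i * x $ \<pi> i)"
  proof (rule injI)
    fix x y :: "real^'n" assume eq: "(\<chi> i. \<epsilon> i * x $ \<pi> i) = (\<chi> i. \<epsilon> i * y $ \<pi> i)"
    have "x $ \<pi> i = y $ \<pi> i" for i
      using arg_cong[OF eq, of "\<lambda>v. \<epsilon> i * v $ i"] by (simp add: sq)
    then show "x = y"
      by (metis inv(1) vec_eq_iff)
  qed
  have mem: "vec_lambda x \<in> \<beta> \<longleftrightarrow> (\<chi> i. \<epsilon> i * x (\<pi> i)) \<in> \<gamma>" for x :: "'n \<Rightarrow> real"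
    using inj_image_mem_iff[OF inj, of "vec_lambda x" \<beta>] by (simp add: pe(3))
  have mem': "vec_lambda x \<in> \<gamma> \<longleftrightarrow> (\<chi> j. \<epsilon> (inv \<pi> j) * x (inv \<pi> j)) \<in> \<beta>" for x :: "'n \<Rightarrow> real"
    unfolding mem by (simp add: inv sq)
  have "essential (\<lambda>x. vec_lambda x \<in> \<beta>) = \<pi> ` essential (\<lambda>x. vec_lambda x \<in> \<gamma>)"
  proof (intro equalityI subsetI)
    fix i assume "i \<in> essential (\<lambda>x. vec_lambda x \<in> \<beta>)"
    then obtain x y where "\<And>j. j \<noteq> i \<Longrightarrow> x j = y j" "(vec_lambda x \<in> \<beta>) \<noteq> (vec_lambda y \<in> \<beta>)"
      by (rule essentialE) blast
    then have "inv \<pi> i \<in> essential (\<lambda>x. vec_lambda x \<in> \<gamma>)"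
      by (intro essentialI[of _ "\<lambda>i. \<epsilon> i * x (\<pi> i)" "\<lambda>i. \<epsilon> i * y (\<pi> i)"]) (auto simp: mem inv inv_iff(1))
    then show "i \<in> \<pi> ` essential (\<lambda>x. vec_lambda x \<in> \<gamma>)"
      by (metis image_eqI inv(1))
  next
    fix i assume "i \<in> \<pi> ` essential (\<lambda>x. vec_lambda x \<in> \<gamma>)"
    then obtain k where k: "i = \<pi> k" "k \<in> essential (\<lambda>x. vec_lambda x \<in> \<gamma>)"
      by auto
    from k(2) obtain x y where "\<And>j. j \<noteq> k \<Longrightarrow> x j = y j" "(vec_lambda x \<in> \<gamma>) \<noteq> (vec_lambda y \<in> \<gamma>)"
      by (rule essentialE) blast
    then show "i \<in> essential (\<lambda>x. vec_lambda x \<in> \<beta>)"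
      unfolding k(1)
      by (intro essentialI[of _ "\<lambda>j. \<epsilon> (inv \<pi> j) * x (inv \<pi> j)" "\<lambda>j. \<epsilon> (inv \<pi> j) * y (inv \<pi> j)"])
        (auto simp: mem' inv inv_iff(2))
  qed
  then show ?thesis
    using pe(1) by (simp add: card_image inj_on_subset[OF bij_is_inj])
qed

lemma congruent_sets_refl: "congruent_sets \<beta> \<beta>"
  unfolding congruent_sets_def
  by (rule exI[of _ id], rule exI[of _ "\<lambda>_. 1"]) (auto simp: sign_vector_def)

section \<open>Evaluation of diagrams, residual formulas and supports\<close>

primrec holds :: "'e spd \<Rightarrow> ('e \<Rightarrow> bool) \<Rightarrow> bool" where
  "holds (Edge e) P \<longleftrightarrow> P e"
| "holds (Series D1 D2) P \<longleftrightarrow> holds D1 P \<and> holds D2 P"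
| "holds (Parallel D1 D2) P \<longleftrightarrow> holds D1 P \<or> holds D2 P"

lemma holds_mono: "holds D P \<Longrightarrow> (\<And>i. P i \<Longrightarrow> Q i) \<Longrightarrow> holds D Q"
  by (induction D) auto

lemma holds_cong: "(\<And>i. i \<in> edges D \<Longrightarrow> P i = Q i) \<Longrightarrow> holds D P = holds D Q"
  by (induction D) auto

lemma holds_True: "holds D (\<lambda>_. True)" and not_holds_False: "\<not> holds D (\<lambda>_. False)"
  by (induction D) auto

lemma sign_vector_nz: "sign_vector s \<Longrightarrow> s i \<noteq> 0"
  unfolding sign_vector_def by (metis insertE neg_equal_0_iff_equal singletonD zero_neq_one)

lemma sign_vector_cases: "sign_vector s \<Longrightarrow> s i = 1 \<or> s i = -1"
  by (auto simp: sign_vector_def)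

text \<open>Scaling by a sign is an involution, so the image of a half-space is also its
  preimage.\<close>

lemma mem_spd_region:
  fixes x :: "real^'n"
  assumes "sign_vector s"
  shows "x \<in> spd_region s D \<longleftrightarrow> holds D (\<lambda>i. 0 \<le> s i * x $ i)"
proof (induction D)
  case (Edge e)
  have "s e *\<^sub>R (s e *\<^sub>R y) = y" for y :: "real^'n"
    using sign_vector_cases[OF assms, of e] by auto
  then have "x \<in> (*\<^sub>R) (s e) ` coord_halfspace e \<longleftrightarrow> s e *\<^sub>R x \<in> coord_halfspace e"
    by (auto intro: image_eqI[of _ _ "s e *\<^sub>R x"])
  then show ?case
    by (simp add: coord_halfspace_def)
qed auto

text \<open>Near \<open>v\<close> the nonzero coordinates keep their signs, which fixes their
  variables; the variables of zero coordinates stay free and are read from \<open>B\<close>.\<close>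

definition residual :: "('n \<Rightarrow> real) \<Rightarrow> 'n spd \<Rightarrow> real^'n \<Rightarrow> ('n \<Rightarrow> bool) \<Rightarrow> bool" where
  "residual s D v B \<longleftrightarrow> holds D (\<lambda>i. if v $ i = 0 then B i else 0 < s i * v $ i)"

definition support :: "('n \<Rightarrow> real) \<Rightarrow> 'n spd \<Rightarrow> real^'n \<Rightarrow> 'n set" where
  "support s D v = essential (residual s D v)"

lemma support_subset_zeros: "support s D v \<subseteq> {i. v $ i = 0}"
  unfolding support_def residual_def
  by (rule essential_subset) (auto intro!: holds_cong)

lemma support_subset_edges: "support s D v \<subseteq> edges D"
  unfolding support_def residual_def
  by (rule essential_subset) (auto intro!: holds_cong)

lemma support_cong:
  assumes "\<And>i. i \<in> edges D \<Longrightarrow> v $ i = w $ i"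
  shows "support s D v = support s D w"
proof -
  have "residual s D v = residual s D w"
    unfolding residual_def using assms by (intro ext holds_cong) auto
  then show ?thesis
    by (simp add: support_def)
qed

lemma sgn_eq_near:
  fixes v :: "real^'n"
  obtains \<delta> where "\<delta> > 0" "\<And>u i. (\<And>j. \<bar>u $ j - v $ j\<bar> \<le> \<delta>) \<Longrightarrow> v $ i \<noteq> 0 \<Longrightarrow> sgn (u $ i) = sgn (v $ i)"
proof
  \<comment> \<open>A move by at most half of the least nonzero absolute value cannot change a sign;
    the inserted 1 keeps \<open>Min\<close> meaningful at \<open>v = 0\<close>.\<close>
  define \<delta> where "\<delta> = Min (insert 1 ((\<lambda>i. \<bar>v $ i\<bar> / 2) ` {i. v $ i \<noteq> 0}))"
  show "\<delta> > 0"
    by (auto simp: \<delta>_def)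
  fix u :: "real^'n" and i assume u: "\<And>j. \<bar>u $ j - v $ j\<bar> \<le> \<delta>" and i: "v $ i \<noteq> 0"
  have "\<delta> \<le> \<bar>v $ i\<bar> / 2"
    unfolding \<delta>_def by (rule Min_le) (use i in auto)
  with u[of i] i show "sgn (u $ i) = sgn (v $ i)"
    by (auto simp: sgn_if abs_if split: if_splits)
qed

text \<open>Every variable fixed at \<open>v\<close> is fixed alike at \<open>u\<close>, so passing
  to \<open>u\<close> can only fix further ones.\<close>

lemma residual_specialize:
  assumes "\<And>i. v $ i \<noteq> 0 \<Longrightarrow> sgn (u $ i) = sgn (v $ i)"
  shows "residual s D u B \<longleftrightarrow> residual s D v (\<lambda>i. if u $ i = 0 then B i else 0 < s i * u $ i)"
  unfolding residual_def
proof (rule holds_cong)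
  show "(if u $ i = 0 then B i else 0 < s i * u $ i) =
      (if v $ i = 0 then if u $ i = 0 then B i else 0 < s i * u $ i else 0 < s i * v $ i)" for i
    using assms[of i] by (auto simp: zero_less_mult_iff sgn_if split: if_splits)
qed

text \<open>Fixing variables creates no new dependence: two assignments that witness it at
  \<open>u\<close> yield witnesses at \<open>v\<close>.\<close>

lemma support_specialize:
  assumes "\<And>i. v $ i \<noteq> 0 \<Longrightarrow> sgn (u $ i) = sgn (v $ i)"
  shows "support s D u \<subseteq> support s D v"
proof
  fix i assume "i \<in> support s D u"
  then obtain x y where xy: "\<And>j. j \<noteq> i \<Longrightarrow> x j = y j" "residual s D u x \<noteq> residual s D u y"
    unfolding support_def by (rule essentialE) blast
  let ?m = "\<lambda>B i. if u $ i = 0 then B i else 0 < s i * u $ i"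
  show "i \<in> support s D v"
    unfolding support_def
  proof (rule essentialI)
    show "residual s D v (?m x) \<noteq> residual s D v (?m y)"
      using xy(2) residual_specialize[of v u s D] assms by simp
  qed (simp add: xy(1))
qed

text \<open>The variables newly fixed at \<open>u\<close> lie outside the support, so the residual
  at \<open>v\<close> does not depend on them.\<close>

lemma residual_eq_specialize:
  assumes "\<And>i. v $ i \<noteq> 0 \<Longrightarrow> sgn (u $ i) = sgn (v $ i)" and "\<And>i. i \<in> support s D v \<Longrightarrow> u $ i = 0"
  shows "residual s D u = residual s D v"
proof
  fix B
  show "residual s D u B = residual s D v B"
    using residual_specialize[of v u s D B] assms
      essential_cong[of "residual s D v" "\<lambda>i. if u $ i = 0 then B i else 0 < s i * u $ i" B]
    by (simp add: support_def)
qed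

text \<open>The half-spaces are closed, so a zero coordinate counts as satisfied.\<close>

lemma residual_True:
  assumes "sign_vector s"
  shows "residual s D v (\<lambda>_. True) \<longleftrightarrow> v \<in> spd_region s D"
  unfolding residual_def mem_spd_region[OF assms]
  by (rule holds_cong) (use sign_vector_nz[OF assms] in \<open>auto simp: less_le\<close>)

lemma residual_mono: "residual s D v B \<Longrightarrow> (\<And>i. B i \<Longrightarrow> C i) \<Longrightarrow> residual s D v C"
  unfolding residual_def by (erule holds_mono) (auto split: if_splits)

section \<open>Tangent cones as residual formulas\<close>

lemma union_of_orthants_residual:
  assumes s: "sign_vector s"
  shows "union_of_orthants {x. residual s D v (\<lambda>i. 0 \<le> s i * x $ i)}" (is "union_of_orthants ?C")
  unfolding union_of_orthants_def
proof (intro exI conjI)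
  let ?S = "{t. sign_vector t \<and> orthant t \<subseteq> ?C}"
  show "\<forall>t\<in>?S. sign_vector t"
    by simp
  have "x \<in> (\<Union>t\<in>?S. orthant t)" if x: "x \<in> ?C" for x
  proof -
    \<comment> \<open>Every half-space condition true at \<open>x\<close> stays true on the orthant
      of \<open>t\<close>; monotonicity of the residual then keeps that orthant inside the
      cone.\<close>
    define t where "t i = (if 0 \<le> s i * x $ i then s i else - s i)" for i
    have t: "sign_vector t"
      using s by (auto simp: t_def sign_vector_def)
    have "orthant t \<subseteq> ?C"
    proof
      fix y assume y: "y \<in> orthant t"
      have "0 \<le> s i * y $ i" if "0 \<le> s i * x $ i" for i
        using y that unfolding orthant_def t_def by (auto dest!: spec[of _ i])
      with x show "y \<in> ?C"
        by (auto elim: residual_mono)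
    qed
    moreover have "x \<in> orthant t"
      by (auto simp: orthant_def t_def)
    ultimately show ?thesis
      using t by blast
  qed
  then show "?C = (\<Union>t\<in>?S. orthant t)"
    by blast
qed

lemma tangent_cone_spd_region:
  assumes s: "sign_vector s"
  shows "tangent_cone (spd_region s D) v = {x. residual s D v (\<lambda>i. 0 \<le> s i * x $ i)}" (is "_ = ?C")
proof -
  obtain \<delta> where \<delta>: "\<delta> > 0"
      "\<And>u i. (\<And>j. \<bar>u $ j - v $ j\<bar> \<le> \<delta>) \<Longrightarrow> v $ i \<noteq> 0 \<Longrightarrow> sgn (u $ i) = sgn (v $ i)"
    using sgn_eq_near[of v] by blast
  have "v + x \<in> spd_region s D \<longleftrightarrow> x \<in> ?C" if "x \<in> cube \<delta>" for x
  proof -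
    have sg: "v $ i \<noteq> 0 \<Longrightarrow> sgn ((v + x) $ i) = sgn (v $ i)" for i
      using \<delta>(2)[of "v + x" i] that by (simp add: mem_cube)
    \<comment> \<open>Membership is read as a residual with all free variables true, so that
      \<open>residual_specialize\<close> can replace \<open>v + x\<close> by
      \<open>v\<close>.\<close>
    have "v + x \<in> spd_region s D \<longleftrightarrow> residual s D (v + x) (\<lambda>_. True)"
      by (simp add: residual_True[OF s])
    also have "\<dots> \<longleftrightarrow> residual s D v (\<lambda>i. if (v + x) $ i = 0 then True else 0 < s i * (v + x) $ i)"
      by (rule residual_specialize) (rule sg)
    also have "\<dots> \<longleftrightarrow> x \<in> ?C"
      unfolding mem_Collect_eq residual_def
      by (rule holds_cong) (use sign_vector_nz[OF s] in \<open>auto simp: less_le\<close>)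
    finally show ?thesis .
  qed
  then have tc: "is_tangent_cone (spd_region s D) v ?C"
    unfolding is_tangent_cone_iff using union_of_orthants_residual[OF s] \<delta>(1) by blast
  then show ?thesis
    unfolding tangent_cone_def
    by (rule the_equality) (rule equalityI[OF is_tangent_cone_mono[OF _ tc] is_tangent_cone_mono[OF tc]])
qed

text \<open>By \<open>essential_comp_halfspace\<close>, the essential coordinates of the tangent
  cone are exactly the support.\<close>

lemma congruent_tangent_cones_card:
  assumes s: "sign_vector s"
    and "congruent_sets (tangent_cone (spd_region s D) v) (tangent_cone (spd_region s D) u)"
  shows "card (support s D v) = card (support s D u)"
  using congruent_sets_card_essential[OF assms(2)] sign_vector_nz[OF s]
  by (simp add: tangent_cone_spd_region[OF s] essential_comp_halfspace support_def)

section \<open>Starlikeness of the set of points with a given support\<close>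

text \<open>The two sets constrain disjoint groups of coordinates, so their centres can be glued
  into a common one.\<close>

lemma starlike_Int_separated:
  fixes S T :: "(real^'n) set"
  assumes "starlike S" "starlike T" "A \<inter> B = {}"
    and S: "\<And>v w. (\<And>i. i \<in> A \<Longrightarrow> v $ i = w $ i) \<Longrightarrow> v \<in> S \<longleftrightarrow> w \<in> S"
    and T: "\<And>v w. (\<And>i. i \<in> B \<Longrightarrow> v $ i = w $ i) \<Longrightarrow> v \<in> T \<longleftrightarrow> w \<in> T"
  shows "starlike (S \<inter> T)"
proof -
  obtain p q where p: "p \<in> S" "\<And>x. x \<in> S \<Longrightarrow> closed_segment p x \<subseteq> S"
    and q: "q \<in> T" "\<And>x. x \<in> T \<Longrightarrow> closed_segment q x \<subseteq> T"
    using assms(1,2) unfolding starlike_def by blast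
  define r where "r = (\<chi> i. if i \<in> A then p $ i else q $ i)"
  have rA: "r $ i = p $ i" if "i \<in> A" for i
    using that by (simp add: r_def)
  have rB: "r $ i = q $ i" if "i \<in> B" for i
    using that assms(3) by (auto simp: r_def)
  have "u \<in> S \<inter> T" if x: "x \<in> S \<inter> T" and u: "u \<in> closed_segment r x" for x u
  proof -
    obtain t where t: "0 \<le> t" "t \<le> 1" "u = (1 - t) *\<^sub>R r + t *\<^sub>R x"
      using u by (auto simp: in_segment)
    have "(1 - t) *\<^sub>R p + t *\<^sub>R x \<in> S" "(1 - t) *\<^sub>R q + t *\<^sub>R x \<in> T"
      using p(2)[of x] q(2)[of x] x t(1,2) unfolding subset_iff in_segment by blast+
    moreover have "u \<in> S \<longleftrightarrow> (1 - t) *\<^sub>R p + t *\<^sub>R x \<in> S"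
      by (rule S) (simp add: t(3) rA)
    moreover have "u \<in> T \<longleftrightarrow> (1 - t) *\<^sub>R q + t *\<^sub>R x \<in> T"
      by (rule T) (simp add: t(3) rB)
    ultimately show ?thesis
      by simp
  qed
  moreover have "r \<in> S \<inter> T"
    using p(1) q(1) S[of r p] T[of r q] rA rB by simp
  ultimately show ?thesis
    unfolding starlike_def by blast
qed

text \<open>By monotonicity only the all-false assignment needs testing; zero coordinates then count
  as false, hence the strict inequality.\<close>

lemma residual_all_iff: "(\<forall>B. residual s D v B) \<longleftrightarrow> holds D (\<lambda>i. 0 < s i * v $ i)"
proof -
  have "residual s D v (\<lambda>_. False) \<longleftrightarrow> holds D (\<lambda>i. 0 < s i * v $ i)"
    unfolding residual_def by (rule holds_cong) auto
  then show ?thesis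
    by (metis residual_mono)
qed

text \<open>Dually, only the all-true assignment needs testing, hence the weak inequality.\<close>

lemma residual_none_iff:
  assumes "sign_vector s"
  shows "(\<forall>B. \<not> residual s D v B) \<longleftrightarrow> \<not> holds D (\<lambda>i. 0 \<le> s i * v $ i)"
  using residual_True[OF assms, of D v] mem_spd_region[OF assms, of v D] by (metis residual_mono)

text \<open>The centre is \<open>s\<close>: towards it, each \<open>s i * v $ i\<close> is averaged
  with 1, so positive values stay positive and the monotone formula stays true.\<close>

lemma starlike_residual_all:
  fixes D :: "'n::finite spd"
  assumes s: "sign_vector s"
  shows "starlike {v. \<forall>B. residual s D v B}"
proof -
  have sq: "s i * s i = 1" for i
    using sign_vector_cases[OF s, of i] by auto
  have "holds D (\<lambda>i. 0 < s i * u $ i)"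
    if v: "holds D (\<lambda>i. 0 < s i * v $ i)" and u: "u \<in> closed_segment (vec_lambda s) v" for u v
  proof -
    obtain t where t: "0 \<le> t" "t \<le> 1" "u = (1 - t) *\<^sub>R vec_lambda s + t *\<^sub>R v"
      using u by (auto simp: in_segment)
    have eq: "s i * u $ i = (1 - t) + t * (s i * v $ i)" for i
      using sq[of i] by (simp add: t(3) algebra_simps)
    show ?thesis
    proof (rule holds_mono[OF v])
      fix i assume "0 < s i * v $ i"
      with t show "0 < s i * u $ i"
        unfolding eq by (cases "t = 1") (auto intro: add_pos_nonneg)
    qed
  qed
  moreover have "holds D (\<lambda>i. 0 < s i * vec_lambda s $ i)"
    by (simp add: sq holds_True)
  ultimately show ?thesis
    unfolding starlike_def residual_all_iff by blast
qed

text \<open>The centre is \<open>- s\<close>: towards it, each \<open>s i * v $ i\<close> is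
  averaged with -1, so a condition that fails at \<open>v\<close> fails on the whole
  segment.\<close>

lemma starlike_residual_none:
  fixes D :: "'n::finite spd"
  assumes s: "sign_vector s"
  shows "starlike {v. \<forall>B. \<not> residual s D v B}"
proof -
  have sq: "s i * s i = 1" for i
    using sign_vector_cases[OF s, of i] by auto
  have "\<not> holds D (\<lambda>i. 0 \<le> s i * u $ i)"
    if v: "\<not> holds D (\<lambda>i. 0 \<le> s i * v $ i)" and u: "u \<in> closed_segment (- vec_lambda s) v" for u v
  proof
    assume h: "holds D (\<lambda>i. 0 \<le> s i * u $ i)"
    obtain t where t: "0 \<le> t" "t \<le> 1" "u = (1 - t) *\<^sub>R (- vec_lambda s) + t *\<^sub>R v"
      using u by (auto simp: in_segment)
    have eq: "s i * u $ i = t * (s i * v $ i) - (1 - t)" for i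
      using sq[of i] by (simp add: t(3) algebra_simps)
    have "holds D (\<lambda>i. 0 \<le> s i * v $ i)"
    proof (rule holds_mono[OF h])
      fix i assume "0 \<le> s i * u $ i"
      then have "1 - t \<le> t * (s i * v $ i)"
        by (simp add: eq)
      with t show "0 \<le> s i * v $ i"
        by (cases "t = 0") (auto simp: zero_le_mult_iff dest: order_trans[rotated, of _ _ 0])
    qed
    with v show False ..
  qed
  moreover have "\<not> holds D (\<lambda>i. 0 \<le> s i * (- vec_lambda s) $ i)"
    by (simp add: sq not_holds_False)
  ultimately show ?thesis
    unfolding starlike_def residual_none_iff[OF s] by blast
qed

text \<open>By De Morgan, \<open>Q = id\<close> covers series and \<open>Q = Not\<close> covers parallel connections.\<close>

lemma starlike_support_connection:
  fixes D1 D2 :: "'n::finite spd"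
  assumes disj: "edges D1 \<inter> edges D2 = {}" and ne: "I \<inter> (edges D1 \<union> edges D2) \<noteq> {}"
    and conn: "\<And>v. support s D v = essential (\<lambda>B. Q (residual s D1 v B) \<and> Q (residual s D2 v B))"
    and Q: "\<And>f. essential (\<lambda>B::'n \<Rightarrow> bool. Q (f B)) = essential f"
    and IH: "\<And>D. D \<in> {D1, D2} \<Longrightarrow> I \<inter> edges D \<noteq> {} \<Longrightarrow> starlike {v. support s D v = I \<inter> edges D}"
    and const: "\<And>D. D \<in> {D1, D2} \<Longrightarrow> starlike {v. \<forall>B. Q (residual s D v B)}"
  shows "starlike {v. support s D v = I \<inter> (edges D1 \<union> edges D2)}"
proof -
  \<comment> \<open>Stated for arbitrary parts, the first of which meets \<open>I\<close>, so that
    it also applies with \<open>D1\<close> and \<open>D2\<close> exchanged.\<close>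
  have main: "starlike {v. support s D v = I \<inter> (edges D1 \<union> edges D2)}"
    if 1: "I \<inter> edges D1 \<noteq> {}" and disj: "edges D1 \<inter> edges D2 = {}"
      and conn: "\<And>v. support s D v = essential (\<lambda>B. Q (residual s D1 v B) \<and> Q (residual s D2 v B))"
      and IH: "\<And>D. D \<in> {D1, D2} \<Longrightarrow> I \<inter> edges D \<noteq> {} \<Longrightarrow> starlike {v. support s D v = I \<inter> edges D}"
      and const: "\<And>D. D \<in> {D1, D2} \<Longrightarrow> starlike {v. \<forall>B. Q (residual s D v B)}"
    for D1 D2 :: "'n spd"
  proof -
    let ?S = "{v. support s D1 v = I \<inter> edges D1}"
    \<comment> \<open>If \<open>I\<close> misses the second part, that part must be neutral for the
      connection: constantly true in series, constantly false in parallel.\<close>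
    let ?T = "{v. if I \<inter> edges D2 = {} then \<forall>B. Q (residual s D2 v B) else support s D2 v = I \<inter> edges D2}"
    have "{v. support s D v = I \<inter> (edges D1 \<union> edges D2)} = ?S \<inter> ?T"
      unfolding conn using support_subset_edges[of s D1] support_subset_edges[of s D2]
      by (auto simp: essential_conj_eq_iff[OF _ _ disj 1] Q support_def)
    moreover have "starlike (?S \<inter> ?T)"
    proof (rule starlike_Int_separated[OF _ _ disj])
      show "starlike ?S"
        using IH 1 by simp
      show "starlike ?T"
        using IH[of D2] const[of D2] by (cases "I \<inter> edges D2 = {}") simp_all
      show "v \<in> ?S \<longleftrightarrow> w \<in> ?S" if "\<And>i. i \<in> edges D1 \<Longrightarrow> v $ i = w $ i" for v w
        using support_cong[of D1 v w s] that by simp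
      show "v \<in> ?T \<longleftrightarrow> w \<in> ?T" if "\<And>i. i \<in> edges D2 \<Longrightarrow> v $ i = w $ i" for v w
      proof -
        have "residual s D2 v = residual s D2 w"
          unfolding residual_def using that by (intro ext holds_cong) auto
        then show ?thesis
          by (simp add: support_def)
      qed
    qed
    ultimately show ?thesis
      by simp
  qed
  show ?thesis
  proof (cases "I \<inter> edges D1 = {}")
    case False
    then show ?thesis
      using main[OF _ disj conn IH const] by blast
  next
    case True
    have "support s D v = essential (\<lambda>B. Q (residual s D2 v B) \<and> Q (residual s D1 v B))" for v
      unfolding conn by (simp add: conj_commute)
    moreover have "I \<inter> edges D2 \<noteq> {}"
      using True ne by blast
    ultimately show ?thesis
      using main[of D2 D1] disj IH const by (simp add: Un_commute Int_commute insert_commute)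
  qed
qed

text \<open>A single edge gives a coordinate hyperplane, and connections preserve starlikeness. If
  \<open>I\<close> missed the edges, the set would mix points of constantly true and constantly
  false residual.\<close>

lemma starlike_support:
  fixes D :: "'n::finite spd"
  assumes s: "sign_vector s" and "read_once D" "I \<inter> edges D \<noteq> {}"
  shows "starlike {v. support s D v = I \<inter> edges D}"
  using assms(2,3)
proof (induction D)
  case (Edge e)
  have ess: "essential (\<lambda>B::'n \<Rightarrow> bool. B e) = {e}"
    by (auto intro: essentialI[of e "\<lambda>i. i = e" "\<lambda>_. False"] elim!: essentialE)
  have "support s (Edge e) v = {e} \<longleftrightarrow> v $ e = 0" for v
    using ess by (auto simp: support_def residual_def essential_def)
  moreover have "starlike {v::real^'n. v $ e = 0}"
    by (intro convex_imp_starlike) (auto simp: convex_def intro: exI[of _ 0])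
  ultimately show ?case
    using Edge by (simp add: Int_insert_right_if1)
next
  case (Series D1 D2)
  have "support s (Series D1 D2) v = essential (\<lambda>B. id (residual s D1 v B) \<and> id (residual s D2 v B))" for v
    unfolding support_def by (rule arg_cong[of _ _ essential]) (simp add: fun_eq_iff residual_def)
  then show ?case
    using Series starlike_residual_all[OF s]
      starlike_support_connection[of D1 D2 I s "Series D1 D2" id] by auto
next
  case (Parallel D1 D2)
  have "support s (Parallel D1 D2) v = essential (\<lambda>B. \<not> residual s D1 v B \<and> \<not> residual s D2 v B)" for v
    unfolding support_def essential_not[of "residual s (Parallel D1 D2) v", symmetric]
    by (rule arg_cong[of _ _ essential]) (simp add: fun_eq_iff residual_def)
  then show ?case
    using Parallel starlike_residual_none[OF s] essential_not
      starlike_support_connection[of D1 D2 I s "Parallel D1 D2" Not] by auto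
qed

section \<open>Genericity regions as sets of constant support\<close>

lemma sgn_eq_near_dist:
  fixes v :: "real^'n"
  obtains \<delta> where "\<delta> > 0" "\<And>u i. dist u v \<le> \<delta> \<Longrightarrow> v $ i \<noteq> 0 \<Longrightarrow> sgn (u $ i) = sgn (v $ i)"
proof -
  obtain \<delta> where \<delta>: "\<delta> > 0"
      "\<And>u i. (\<And>j. \<bar>u $ j - v $ j\<bar> \<le> \<delta>) \<Longrightarrow> v $ i \<noteq> 0 \<Longrightarrow> sgn (u $ i) = sgn (v $ i)"
    using sgn_eq_near[of v] by blast
  have "\<bar>u $ j - v $ j\<bar> \<le> \<delta>" if "dist u v \<le> \<delta>" for u j
    using component_le_norm_cart[of "u - v" j] that by (simp add: dist_norm)
  with \<delta> show ?thesis
    using that by blast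
qed

text \<open>Locally along the path the support can only shrink, while congruence keeps its size; so
  it is locally constant on a connected set.\<close>

lemma genericity_region_support_eq:
  fixes v :: "real^'n"
  assumes s: "sign_vector s" and w: "w \<in> genericity_region (spd_region s D) v"
  shows "support s D w = support s D v"
proof -
  let ?\<alpha> = "spd_region s D"
  obtain g where g: "path g" "pathstart g = v" "pathfinish g = w"
      "\<And>u. u \<in> path_image g \<Longrightarrow> congruent_sets (tangent_cone ?\<alpha> v) (tangent_cone ?\<alpha> u)"
    using w by (auto simp: genericity_region_def)
  have card: "card (support s D u) = card (support s D v)" if "u \<in> path_image g" for u
    using congruent_tangent_cones_card[OF s g(4)[OF that]] by simp
  have "support s D v = support s D w"
  proof (rule connected_local_const)
    show "connected (path_image g)" "v \<in> path_image g" "w \<in> path_image g"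
      using g by (auto simp: connected_path_image)
    show "\<forall>a\<in>path_image g. \<forall>\<^sub>F b in at a within path_image g. support s D a = support s D b"
    proof
      fix a assume a: "a \<in> path_image g"
      obtain \<delta> where \<delta>: "\<delta> > 0" "\<And>u i. dist u a \<le> \<delta> \<Longrightarrow> a $ i \<noteq> 0 \<Longrightarrow> sgn (u $ i) = sgn (a $ i)"
        using sgn_eq_near_dist[of a] by blast
      have "support s D a = support s D b" if "b \<in> path_image g" "dist b a < \<delta>" for b
      proof -
        have "support s D b \<subseteq> support s D a"
          using \<delta>(2)[of b] that(2) by (intro support_specialize) auto
        then show ?thesis
          using card[OF a] card[OF that(1)] by (metis card_subset_eq finite)
      qed
      then show "\<forall>\<^sub>F b in at a within path_image g. support s D a = support s D b"
        unfolding eventually_at using \<delta>(1) by blast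
    qed
  qed
  then show ?thesis ..
qed

text \<open>Equal residuals give equal tangent cones, not merely congruent ones, and they also
  decide membership in the set.\<close>

lemma genericity_region_residual_path:
  fixes v :: "real^'n"
  assumes s: "sign_vector s" and v: "v \<in> spd_region s D"
    and g: "path g" "pathstart g = v" "pathfinish g = w"
    and res: "\<And>u. u \<in> path_image g \<Longrightarrow> residual s D u = residual s D v"
  shows "w \<in> genericity_region (spd_region s D) v"
proof -
  have "u \<in> spd_region s D" if "u \<in> path_image g" for u
    using v res[OF that] unfolding residual_True[OF s, symmetric] by simp
  moreover have "congruent_sets (tangent_cone (spd_region s D) v) (tangent_cone (spd_region s D) u)"
    if "u \<in> path_image g" for u
    unfolding tangent_cone_spd_region[OF s] res[OF that] by (rule congruent_sets_refl)
  moreover have "w \<in> path_image g"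
    using g(3) by auto
  ultimately show ?thesis
    using g unfolding genericity_region_def by blast
qed

text \<open>Near \<open>v\<close>, moving coordinates outside the support leaves the residual
  unchanged, so a straight segment serves as the path.\<close>

lemma genericity_region_contains_nbhd:
  fixes v :: "real^'n"
  assumes s: "sign_vector s" and v: "v \<in> spd_region s D"
  obtains \<delta> where "\<delta> > 0"
    "\<And>w. dist w v \<le> \<delta> \<Longrightarrow> (\<And>i. i \<in> support s D v \<Longrightarrow> w $ i = 0) \<Longrightarrow> w \<in> genericity_region (spd_region s D) v"
proof -
  obtain \<delta> where \<delta>: "\<delta> > 0" "\<And>u i. dist u v \<le> \<delta> \<Longrightarrow> v $ i \<noteq> 0 \<Longrightarrow> sgn (u $ i) = sgn (v $ i)"
    using sgn_eq_near_dist[of v] by blast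
  have "w \<in> genericity_region (spd_region s D) v"
    if w: "dist w v \<le> \<delta>" "\<And>i. i \<in> support s D v \<Longrightarrow> w $ i = 0" for w
  proof (rule genericity_region_residual_path[OF s v])
    fix u assume "u \<in> path_image (linepath v w)"
    then have u: "u \<in> closed_segment v w"
      by simp
    have "dist u v \<le> \<delta>"
      using dist_in_closed_segment[OF u] w(1) by (simp add: dist_commute)
    moreover have "u $ i = 0" if "i \<in> support s D v" for i
      using u w(2)[OF that] that support_subset_zeros[of s D v] by (auto simp: in_segment)
    ultimately show "residual s D u = residual s D v"
      using \<delta>(2) by (intro residual_eq_specialize)
  qed auto
  with \<delta>(1) show ?thesis
    using that by blast
qed

text \<open>Starlikeness supplies paths inside the set of points with the same support. There the
  residual is locally constant, hence constant.\<close>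

lemma genericity_region_eq:
  fixes v :: "real^'n"
  assumes s: "sign_vector s" and D: "read_once D" "edges D = UNIV" and ne: "support s D v \<noteq> {}"
  shows "genericity_region (spd_region s D) v = {u. support s D u = support s D v}"
proof (intro equalityI subsetI)
  show "u \<in> {u. support s D u = support s D v}" if "u \<in> genericity_region (spd_region s D) v" for u
    using genericity_region_support_eq[OF s that] by simp
next
  let ?S = "{u. support s D u = support s D v}"
  fix w assume w: "w \<in> ?S"
  have pc: "path_connected ?S"
    using starlike_imp_path_connected[OF starlike_support[OF s D(1), of "support s D v"]] ne D(2)
    by simp
  have local_const: "\<forall>\<^sub>F b in at a within ?S. residual s D a = residual s D b" if a: "a \<in> ?S" for a
  proof -
    obtain \<delta> where \<delta>: "\<delta> > 0" "\<And>u i. dist u a \<le> \<delta> \<Longrightarrow> a $ i \<noteq> 0 \<Longrightarrow> sgn (u $ i) = sgn (a $ i)"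
      using sgn_eq_near_dist[of a] by blast
    have "residual s D b = residual s D a" if "b \<in> ?S" "dist b a < \<delta>" for b
      using \<delta>(2)[of b] that a support_subset_zeros[of s D b]
      by (intro residual_eq_specialize) auto
    then show ?thesis
      unfolding eventually_at using \<delta>(1) by metis
  qed
  have res: "residual s D u = residual s D v" if "u \<in> ?S" for u
    using connected_local_const[OF path_connected_imp_connected[OF pc], of u v "residual s D"]
      that local_const by blast
  obtain g where g: "path g" "path_image g \<subseteq> ?S" "pathstart g = v" "pathfinish g = w"
    using pc w unfolding path_connected_def by blast
  \<comment> \<open>A residual with nonempty support is satisfiable; by monotonicity the all-true
    assignment satisfies it, which places \<open>v\<close> in the set.\<close>
  have "\<exists>B. residual s D v B"
    using ne unfolding support_def by (auto elim: essentialE)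
  then have "v \<in> spd_region s D"
    unfolding residual_True[OF s, symmetric] by (auto elim: residual_mono)
  then show "w \<in> genericity_region (spd_region s D) v"
    using genericity_region_residual_path[OF s _ g(1,3,4)] g(2) res by blast
qed

section \<open>Coordinate flats and the degree of a genericity region\<close>

lemma aff_dim_coord_flat:
  fixes I :: "'n::finite set"
  shows "aff_dim (coord_flat I c) = int (CARD('n) - card I)"
proof -
  let ?a = "(\<chi> i. c i) :: real^'n"
  have "coord_flat I c = (+) ?a ` coord_flat I (\<lambda>_. 0)"
  proof (intro equalityI subsetI)
    fix x assume "x \<in> coord_flat I c"
    then show "x \<in> (+) ?a ` coord_flat I (\<lambda>_. 0)"
      by (intro image_eqI[of _ _ "x - ?a"]) (auto simp: coord_flat_def)
  qed (auto simp: coord_flat_def)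
  then have "aff_dim (coord_flat I c) = aff_dim (coord_flat I (\<lambda>_. 0))"
    by (simp add: aff_dim_translation_eq)
  also have "\<dots> = int (dim (coord_flat I (\<lambda>_. 0)))"
    by (intro aff_dim_subspace subspaceI) (auto simp: coord_flat_def)
  also have "dim (coord_flat I (\<lambda>_. 0)) = CARD('n) - card I"
    using dim_substandard_cart[of "- I", where 'a = real]
    by (simp add: coord_flat_def Ball_def dim_vec_eq Compl_eq_Diff_UNIV card_Diff_subset)
  finally show ?thesis .
qed

lemma genericity_region_subset_coord_flat:
  fixes v :: "real^'n"
  assumes s: "sign_vector s"
  shows "genericity_region (spd_region s D) v \<subseteq> coord_flat (support s D v) (\<lambda>_. 0)"
  using genericity_region_support_eq[OF s] support_subset_zeros[of s D]
  unfolding coord_flat_def by blast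

text \<open>A coordinate outside the support can be shifted slightly without leaving the region, so
  no flat containing the region fixes it.\<close>

lemma coord_flat_contains_genericity_region:
  fixes v :: "real^'n"
  assumes s: "sign_vector s" and v: "v \<in> spd_region s D"
    and sub: "genericity_region (spd_region s D) v \<subseteq> coord_flat I c"
  shows "I \<subseteq> support s D v"
proof
  fix i assume i: "i \<in> I"
  obtain \<delta> where \<delta>: "\<delta> > 0" "\<And>w. dist w v \<le> \<delta> \<Longrightarrow> (\<And>i. i \<in> support s D v \<Longrightarrow> w $ i = 0) \<Longrightarrow>
      w \<in> genericity_region (spd_region s D) v"
    using genericity_region_contains_nbhd[OF s v] by blast
  have zero: "v $ j = 0" if "j \<in> support s D v" for j
    using that support_subset_zeros[of s D v] by blast
  show "i \<in> support s D v"
  proof (rule ccontr)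
    assume ni: "i \<notin> support s D v"
    let ?w = "v + \<delta> *\<^sub>R axis i 1"
    have "v \<in> coord_flat I c"
      using \<delta>(1) \<delta>(2)[of v] zero sub by auto
    moreover have "?w \<in> coord_flat I c"
    proof (rule subsetD[OF sub \<delta>(2)])
      show "dist ?w v \<le> \<delta>"
        using \<delta>(1) by (simp add: dist_norm norm_axis_1)
      show "?w $ j = 0" if "j \<in> support s D v" for j
        using ni that zero[OF that] by (auto simp: axis_def)
    qed
    ultimately show False
      using i \<delta>(1) by (auto simp: coord_flat_def axis_def)
  qed
qed

text \<open>Among the flats containing the region, the one that fixes exactly the support has the
  least dimension.\<close>

lemma region_degree_genericity_region:
  fixes v :: "real^'n"
  assumes s: "sign_vector s" and v: "v \<in> spd_region s D"
  shows "region_degree (genericity_region (spd_region s D) v) = CARD('n) - card (support s D v)"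
  unfolding region_degree_def
proof (rule Least_equality)
  show "\<exists>I c. genericity_region (spd_region s D) v \<subseteq> coord_flat I c \<and>
      aff_dim (coord_flat I c) = int (CARD('n) - card (support s D v))"
    using genericity_region_subset_coord_flat[OF s] aff_dim_coord_flat by blast
next
  fix n assume "\<exists>I c. genericity_region (spd_region s D) v \<subseteq> coord_flat I c \<and>
      aff_dim (coord_flat I c) = int n"
  then obtain I c where "genericity_region (spd_region s D) v \<subseteq> coord_flat I c"
      "CARD('n) - card I = n"
    by (auto simp: aff_dim_coord_flat)
  moreover from this have "card I \<le> card (support s D v)"
    using coord_flat_contains_genericity_region[OF s v] by (simp add: card_mono)
  ultimately show "CARD('n) - card (support s D v) \<le> n"
    by simp
qed

section \<open>Faces in generalized coordinate hyperplanes\<close>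

theorem proposition3p2:
  fixes \<alpha> :: "(real^'n) set" and k :: nat
  assumes "floral_vertex \<alpha>" and "0 < k" and "k < CARD('n)"
  shows "(\<forall>G. is_genericity_region \<alpha> G \<and> region_degree G = k \<longrightarrow> is_face \<alpha> k (closure G)) \<and>
         (\<forall>I :: 'n set. card I = CARD('n) - k \<longrightarrow>
            (\<exists>!F. is_face \<alpha> k F \<and> F \<subseteq> coord_flat I (\<lambda>_. 0)))"
proof (intro conjI allI impI)
  fix G assume "is_genericity_region \<alpha> G \<and> region_degree G = k"
  then show "is_face \<alpha> k (closure G)"
    unfolding is_face_def by blast
next
  fix I :: "'n set" assume I: "card I = CARD('n) - k"
  obtain D s where D: "read_once D" "edges D = UNIV" and s: "sign_vector s"
      and \<alpha>: "\<alpha> = spd_region s D"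
    using assms(1) unfolding floral_vertex_def by blast
  \<comment> \<open>Here \<open>k < CARD('n)\<close> enters; a nonempty support is what identifies a
    genericity region with a set of constant support.\<close>
  have Ine: "I \<noteq> {}"
    using I assms by auto
  let ?G = "{u. support s D u = I}"
  have reg: "genericity_region \<alpha> v = ?G" if "support s D v = I" for v
    using genericity_region_eq[OF s D, of v] that Ine by (simp add: \<alpha>)
  have closed: "closed (coord_flat I (\<lambda>_. 0) :: (real^'n) set)"
  proof -
    have "coord_flat I (\<lambda>_. 0) = (\<Inter>i\<in>I. {x::real^'n. x $ i = 0})"
      by (auto simp: coord_flat_def)
    then show ?thesis
      by (auto intro!: closed_INT closed_Collect_eq continuous_intros)
  qed
  show "\<exists>!F. is_face \<alpha> k F \<and> F \<subseteq> coord_flat I (\<lambda>_. 0)"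
  proof (rule ex1I[of _ "closure ?G"], intro conjI)
    \<comment> \<open>A starlike set is nonempty by definition, so some point has support
      \<open>I\<close>.\<close>
    obtain v where v: "support s D v = I"
      using starlike_support[OF s D(1), of I] Ine D(2) by (auto simp: starlike_def)
    then have "v \<in> \<alpha>"
      using reg[OF v] unfolding genericity_region_def by blast
    then have "is_genericity_region \<alpha> ?G"
      using reg[OF v] unfolding is_genericity_region_def by blast
    moreover have "region_degree ?G = k"
      using region_degree_genericity_region[OF s, of v D] \<open>v \<in> \<alpha>\<close> reg[OF v] I v assms(3)
      by (simp add: \<alpha>)
    ultimately show "is_face \<alpha> k (closure ?G)"
      unfolding is_face_def by blast
    show "closure ?G \<subseteq> coord_flat I (\<lambda>_. 0)"
      using support_subset_zeros[of s D]
      by (intro closure_minimal closed) (auto simp: coord_flat_def)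
  next
    fix F assume F: "is_face \<alpha> k F \<and> F \<subseteq> coord_flat I (\<lambda>_. 0)"
    then obtain w where w: "w \<in> \<alpha>" "region_degree (genericity_region \<alpha> w) = k"
        "F = closure (genericity_region \<alpha> w)"
      unfolding is_face_def is_genericity_region_def by blast
    have "genericity_region \<alpha> w \<subseteq> coord_flat I (\<lambda>_. 0)"
      using F w(3) closure_subset by blast
    then have "I \<subseteq> support s D w"
      using coord_flat_contains_genericity_region[OF s] w(1) by (simp add: \<alpha>)
    \<comment> \<open>Equal degrees give equal sizes; \<open>0 < k\<close> allows the truncated
      subtraction to be undone.\<close>
    moreover have "card (support s D w) = card I"
      using w(1,2) region_degree_genericity_region[OF s, of w D] I assms(2,3) by (simp add: \<alpha>)
    ultimately have "support s D w = I"
      by (metis card_subset_eq finite)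
    then show "F = closure ?G"
      using reg w(3) by simp
  qed
qed

end
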